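(* Let $\mathtt{Compress}_{\mathtt{SR}}:\Sigma^*\to(\Sigma')^*$ be the LZ77 compression function with self-referencing and unbounded sliding window size $W=n$, as described in the context. Then, for strings of length $n$, $$\mathrm{GS}_{\mathtt{Compress}_{\mathtt{SR}}}\le\Big(\tfrac{\sqrt[3]{9}}{2}n^{2/3}+\tfrac{\sqrt[3]{3}}{2}n^{1/3}+3\Big)\big(2\lceil\log n\rceil+\lceil\log|\Sigma|\rceil\big)=O(n^{2/3}\log n).$$
   Context: All logarithms are base 2. For $w\in\Sigma^n$, $w[i]$ is its $i$-th character and $w[a,b]$ the substring from position $a$ to $b$. LZ77 with self-referencing and window $W\le n$: the output on $w\in\Sigma^n$ is a sequence of blocks $B_1,\dots,B_t$, $B_i=[q_i,\ell_i,c_i]$ with integers $0\le q_i,\ell_i<n$ and $c_i\in\Sigma$. Greedily, $B_1=[0,0,w[1]]$; if the first $\mathsf{ctc}<n$ characters have been encoded, the next block uses the largest $\ell\ge 0$ (with $\mathsf{ctc}+\ell<n$) such that $w[\mathsf{ctc}+1,\mathsf{ctc}+\ell]=w[q,q+\ell-1]$ for some start position $q$ with $\max\{1,\mathsf{ctc}-W+1\}\le q\le\mathsf{ctc}$ (the copied source may overlap the part being encoded, i.e. $q+\ell-1>\mathsf{ctc}$ is allowed); if $\ell=0$ the block is $[0,0,w[\mathsf{ctc}+1]]$, otherwise it is $[q,\ell,w[\mathsf{ctc}+\ell+1]]$; then $\mathsf{ctc}$ increases by $\ell+1$, and the algorithm stops when $\mathsf{ctc}=n$. Each block is encoded with $2\lceil\log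 n\rceil+\lceil\log|\Sigma|\rceil$ bits, so the output length is $t(2\lceil\log n\rceil+\lceil\log|\Sigma|\rceil)$. Strings $w,w'\in\Sigma^n$ are neighbors ($w\sim w'$) if they differ in exactly one position, and the global sensitivity is $\max_{w\in\Sigma^n}\max_{w'\sim w}\big||\mathtt{Compress}_{\mathtt{SR}}(w)|-|\mathtt{Compress}_{\mathtt{SR}}(w')|\big|$. *)

theory Defs
  imports Complex_Main "HOL-Library.Landau_Symbols" "HOL-Library.Countable_Set"
begin

text \<open>Positions in strings are counted from 1; \<open>substring w a b\<close> is $w[a,b]$,
  which is empty for $b = a - 1$.\<close>

definition substring :: "'a list \<Rightarrow> nat \<Rightarrow> nat \<Rightarrow> 'a list" where
  "substring w a b = take (Suc b - a) (drop (a - 1) w)"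

text \<open>The copied source may overlap the part being encoded: there is no condition
  \<open>q + l - 1 \<le> ctc\<close>. The truncated subtraction is harmless because of the \<open>max 1\<close>.\<close>

definition lz77_match :: "nat \<Rightarrow> 'a list \<Rightarrow> nat \<Rightarrow> nat \<Rightarrow> nat \<Rightarrow> bool" where
  "lz77_match W w ctc l q \<longleftrightarrow>
     ctc + l < length w \<and> max 1 (ctc + 1 - W) \<le> q \<and> q \<le> ctc \<and>
     substring w (ctc + 1) (ctc + l) = substring w q (q + l - 1)"

definition lz77_match_length :: "nat \<Rightarrow> 'a list \<Rightarrow> nat \<Rightarrow> nat" where
  "lz77_match_length W w ctc = Max (insert 0 {l. \<exists>q. lz77_match W w ctc l q})"

text \<open>For \<open>ctc = 0\<close> there is no admissible \<open>q\<close>, so the first block is \<open>(0, 0, w[1])\<close>.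
  If several sources \<open>q\<close> attain the maximal length, an arbitrary one is chosen;
  the number of blocks does not depend on this choice.\<close>

type_synonym 'a block = "nat \<times> nat \<times> 'a"

function lz77_blocks_from :: "nat \<Rightarrow> 'a list \<Rightarrow> nat \<Rightarrow> 'a block list" where
  "lz77_blocks_from W w ctc =
     (if ctc \<ge> length w then []
      else let l = lz77_match_length W w ctc in
        (if l = 0 then (0, 0, w ! ctc)
         else (SOME q. lz77_match W w ctc l q, l, w ! (ctc + l)))
        # lz77_blocks_from W w (ctc + l + 1))"
  by pat_completeness auto
termination
  by (relation "measure (\<lambda>(W, w, ctc). length w - ctc)") auto

declare lz77_blocks_from.simps [simp del]

definition lz77_blocks :: "nat \<Rightarrow> 'a list \<Rightarrow> 'a block list" where
  "lz77_blocks W w = lz77_blocks_from W w 0"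

text \<open>Numbers below $n$ are written in binary with $\lceil\log n\rceil$ bits. A character of
  the finite alphabet is written as its index in a fixed enumeration; \<open>to_nat_on \<Sigma>\<close> is
  a bijection from \<open>\<Sigma>\<close> to \<open>{..<card \<Sigma>}\<close>.\<close>

definition bits_for :: "nat \<Rightarrow> nat" where
  "bits_for n = nat \<lceil>log 2 (real n)\<rceil>"

definition binary :: "nat \<Rightarrow> nat \<Rightarrow> bool list" where
  "binary k m = map (bit m) [0..<k]"

fun encode_block :: "'a set \<Rightarrow> nat \<Rightarrow> 'a block \<Rightarrow> bool list" where
  "encode_block \<Sigma> n (q, l, c) =
     binary (bits_for n) q @ binary (bits_for n) l
       @ binary (bits_for (card \<Sigma>)) (to_nat_on \<Sigma> c)"

definition lz77_compress :: "'a set \<Rightarrow> nat \<Rightarrow> 'a list \<Rightarrow> bool list" where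
  "lz77_compress \<Sigma> W w = concat (map (encode_block \<Sigma> (length w)) (lz77_blocks W w))"

lemma length_lz77_compress:
  "length (lz77_compress \<Sigma> W w) =
     length (lz77_blocks W w) * (2 * bits_for (length w) + bits_for (card \<Sigma>))"
proof -
  have "length (encode_block \<Sigma> n B) = 2 * bits_for n + bits_for (card \<Sigma>)" for n B
    by (cases B) (simp add: binary_def)
  then show ?thesis
    by (simp add: lz77_compress_def length_concat comp_def sum_list_triv)
qed

definition compress_SR :: "'a set \<Rightarrow> 'a list \<Rightarrow> bool list" where
  "compress_SR \<Sigma> w = lz77_compress \<Sigma> (length w) w"

definition strings :: "'a set \<Rightarrow> nat \<Rightarrow> 'a list set" where
  "strings \<Sigma> n = {w. set w \<subseteq> \<Sigma> \<and> length w = n}"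

definition neighbors :: "'a list \<Rightarrow> 'a list \<Rightarrow> bool" where
  "neighbors w w' \<longleftrightarrow>
     length w = length w' \<and> (\<exists>!i. i < length w \<and> w ! i \<noteq> w' ! i)"

text \<open>On \<open>nat\<close>, \<open>SUP\<close> is the maximum of a finite nonempty set, and 0 for the empty set.
  For finite \<open>\<Sigma>\<close> all sets below are finite; they are empty only in the degenerate
  cases without neighbors (\<open>n = 0\<close> or \<open>card \<Sigma> \<le> 1\<close>).\<close>

definition global_sensitivity :: "('a list \<Rightarrow> 'b list) \<Rightarrow> 'a set \<Rightarrow> nat \<Rightarrow> nat" where
  "global_sensitivity C \<Sigma> n =
     (SUP w \<in> strings \<Sigma> n. SUP w' \<in> {w' \<in> strings \<Sigma> n. neighbors w w'}.
        nat \<bar>int (length (C w)) - int (length (C w'))\<bar>)"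

end

theory Submission
  imports Defs "HOL-Real_Asymp.Real_Asymp"
begin

text \<open>Let \<open>w\<close> and \<open>w'\<close> differ only at position \<open>p\<close>. A block of \<open>w\<close> copies a segment from
  distance \<open>d\<close>; in \<open>w'\<close> this copy is broken only at positions \<open>p\<close> and \<open>p + d\<close>. Hence at most
  one block of \<open>w'\<close> starts in it, plus one if the source contains \<open>p\<close>, plus two if the block
  itself contains \<open>p\<close>. Two blocks in which a second block of \<open>w'\<close> starts cannot have both the same
  copy length \<open>l\<close> and the same offset \<open>j < l\<close> of \<open>p\<close> in the source, since otherwise \<open>w'\<close> could
  copy the later one from the earlier one. So at most \<open>l\<close> such blocks have copy length \<open>l\<close>, while
  the lengths add up to at most \<open>n\<close>; this forces their number below
  \<open>x\<^sup>2 / 2 + x / 2\<close> with \<open>x\<^sup>3 = 3 n\<close>.\<close>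

section \<open>Greedy blocks as copies from a fixed distance\<close>

definition next_start :: "'a list \<Rightarrow> nat \<Rightarrow> nat" where
  "next_start w c = c + lz77_match_length (length w) w c + 1"

text \<open>Positions are counted from 0 from here on; \<open>d\<close> is the distance \<open>ctc + 1 - q\<close> to the source.\<close>

lemma lz77_match_iff:
  assumes "c < length w"
  shows "(\<exists>q. lz77_match (length w) w c l q) \<longleftrightarrow>
    c + l < length w \<and> (\<exists>d. 1 \<le> d \<and> d \<le> c \<and> (\<forall>i\<in>{c..<c + l}. w ! i = w ! (i - d)))"
    (is "?L \<longleftrightarrow> ?R")
proof -
  have eq: "substring w (c + 1) (c + l) = substring w q (q + l - 1) \<longleftrightarrow>
      (\<forall>i\<in>{c..<c + l}. w ! i = w ! (i - (c + 1 - q)))"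
    if "c + l < length w" "1 \<le> q" "q \<le> c" for q
  proof -
    have "substring w (c + 1) (c + l) = take l (drop c w)"
      by (simp add: substring_def)
    moreover have "substring w q (q + l - 1) = take l (drop (q - 1) w)"
      using that by (cases q) (simp_all add: substring_def)
    moreover have "take l (drop c w) = take l (drop (q - 1) w) \<longleftrightarrow>
        (\<forall>k<l. w ! (c + k) = w ! (q - 1 + k))"
      using that by (simp add: list_eq_iff_nth_eq)
    moreover have "(\<forall>k<l. w ! (c + k) = w ! (q - 1 + k)) \<longleftrightarrow>
        (\<forall>i\<in>{c..<c + l}. w ! i = w ! (i - (c + 1 - q)))"
    proof
      assume k: "\<forall>k<l. w ! (c + k) = w ! (q - 1 + k)"
      show "\<forall>i\<in>{c..<c + l}. w ! i = w ! (i - (c + 1 - q))"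
      proof
        fix i assume "i \<in> {c..<c + l}"
        then show "w ! i = w ! (i - (c + 1 - q))"
          using k[rule_format, of "i - c"] that by (auto simp: add.commute)
      qed
    next
      assume i: "\<forall>i\<in>{c..<c + l}. w ! i = w ! (i - (c + 1 - q))"
      show "\<forall>k<l. w ! (c + k) = w ! (q - 1 + k)"
      proof (intro allI impI)
        fix k assume "k < l"
        then show "w ! (c + k) = w ! (q - 1 + k)"
          using i[rule_format, of "c + k"] that by (auto simp: add.commute)
      qed
    qed
    ultimately show ?thesis by simp
  qed
  show ?thesis
  proof
    assume ?L
    then obtain q where q: "c + l < length w" "1 \<le> q" "q \<le> c"
        "substring w (c + 1) (c + l) = substring w q (q + l - 1)"
      by (auto simp: lz77_match_def)
    then have "\<forall>i\<in>{c..<c + l}. w ! i = w ! (i - (c + 1 - q))"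
      using eq by blast
    with q show ?R by (intro conjI exI[of _ "c + 1 - q"]) auto
  next
    assume ?R
    then obtain d where d: "c + l < length w" "1 \<le> d" "d \<le> c"
        "\<forall>i\<in>{c..<c + l}. w ! i = w ! (i - d)"
      by blast
    then have "substring w (c + 1) (c + l) = substring w (c + 1 - d) (c + 1 - d + l - 1)"
      using eq[of "c + 1 - d"] by simp
    with d assms show ?L
      unfolding lz77_match_def by (intro exI[of _ "c + 1 - d"]) auto
  qed
qed

lemma finite_match_lengths: "finite {l. \<exists>q. lz77_match W w c l q}"
  by (rule finite_subset[of _ "{..<length w}"]) (auto simp: lz77_match_def)

lemma next_start_gt: "c < next_start w c"
  by (simp add: next_start_def)

text \<open>The greedy maximum is attained because only finitely many lengths match. A block is thus
  a single explicit character, or a copy followed by one; \<open>i + 1 < next_start w c\<close>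
  leaves out this last character.\<close>

lemma next_start_copy:
  assumes "c < length w"
  obtains "next_start w c = c + 1"
  | d where "next_start w c \<le> length w" "1 \<le> d" "d \<le> c"
      "\<forall>i. c \<le> i \<and> i + 1 < next_start w c \<longrightarrow> w ! i = w ! (i - d)"
proof -
  let ?l = "lz77_match_length (length w) w c"
  have "?l \<in> insert 0 {l. \<exists>q. lz77_match (length w) w c l q}"
    unfolding lz77_match_length_def by (rule Max_in) (simp_all add: finite_match_lengths)
  then show ?thesis
    using that lz77_match_iff[OF assms, of ?l] by (auto simp: next_start_def)
qed

lemma next_start_le: "c < length w \<Longrightarrow> next_start w c \<le> length w"
  by (rule next_start_copy[of c w]) simp_all

text \<open>A copy that works on the whole segment still works, from the same distance, when started
  at a later position \<open>b\<close>, so the greedy choice at \<open>b\<close> reaches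
  \<open>v\<close>. Position \<open>v - 1\<close> can be the explicit character of the block and
  does not have to match.\<close>

lemma le_next_start:
  assumes "1 \<le> d" "d \<le> u" "v \<le> length w" "b \<in> {u..<v}"
    and "\<And>i. u \<le> i \<Longrightarrow> i + 1 < v \<Longrightarrow> w ! i = w ! (i - d)"
  shows "v \<le> next_start w b"
proof -
  have "\<exists>q. lz77_match (length w) w b (v - 1 - b) q"
    using assms by (subst lz77_match_iff) (auto intro!: exI[of _ d])
  then have "v - 1 - b \<le> lz77_match_length (length w) w b"
    unfolding lz77_match_length_def
    by (intro Max_ge) (simp_all add: finite_match_lengths)
  then show ?thesis
    using assms by (simp add: next_start_def)
qed

section \<open>Block starts as sets of positions\<close>

text \<open>The parse of the suffix from \<open>c\<close>, encoded as disjoint intervals covering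
  it. Counting the blocks that start in a segment becomes the cardinality of an
  intersection.\<close>

definition parse_starts :: "'a list \<Rightarrow> nat \<Rightarrow> nat set \<Rightarrow> bool" where
  "parse_starts w c S \<longleftrightarrow> S \<subseteq> {c..<length w} \<and>
     {c..<length w} \<subseteq> (\<Union>a\<in>S. {a..<next_start w a}) \<and>
     (\<forall>a\<in>S. \<forall>b\<in>S. a < b \<longrightarrow> next_start w a \<le> b)"

lemma parse_starts_finite: "parse_starts w c S \<Longrightarrow> finite S"
  unfolding parse_starts_def using finite_subset by blast

lemma parse_starts_exists:
  "\<exists>S. parse_starts w c S \<and> card S = length (lz77_blocks_from (length w) w c)"
proof (induction "length w - c" arbitrary: c rule: less_induct)
  case less
  show ?case
  proof (cases "c < length w")
    case False
    then show ?thesis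
      by (intro exI[of _ "{}"]) (simp add: lz77_blocks_from.simps parse_starts_def)
  next
    case True
    let ?c = "next_start w c"
    have "length w - ?c < length w - c"
      using True next_start_gt[of c w] by auto
    from less[OF this] obtain S where S: "parse_starts w ?c S"
      "card S = length (lz77_blocks_from (length w) w ?c)"
      by blast
    have "c \<notin> S"
      using S(1) next_start_gt[of c w] by (auto simp: parse_starts_def)
    then have "card (insert c S) = length (lz77_blocks_from (length w) w c)"
      using S True parse_starts_finite[OF S(1)]
      by (subst lz77_blocks_from.simps) (simp add: Let_def next_start_def)
    moreover have "parse_starts w c (insert c S)"
    proof -
      have S': "S \<subseteq> {?c..<length w}" "{?c..<length w} \<subseteq> (\<Union>a\<in>S. {a..<next_start w a})"
          "\<forall>a\<in>S. \<forall>b\<in>S. a < b \<longrightarrow> next_start w a \<le> b"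
        using S(1) by (auto simp: parse_starts_def)
      have "{c..<length w} \<subseteq> {c..<?c} \<union> {?c..<length w}"
        by auto
      then have "{c..<length w} \<subseteq> (\<Union>a\<in>insert c S. {a..<next_start w a})"
        using S'(2) by blast
      moreover have "insert c S \<subseteq> {c..<length w}"
        using S'(1) True next_start_gt[of c w] by auto
      moreover have "next_start w a \<le> b" if "a \<in> insert c S" "b \<in> insert c S" "a < b" for a b
        using that S'(1,3) next_start_gt[of c w] by auto
      ultimately show ?thesis
        unfolding parse_starts_def by blast
    qed
    ultimately show ?thesis by blast
  qed
qed

text \<open>The block of the first start in the segment already extends to \<open>v\<close> or
  beyond.\<close>

lemma card_starts_le_1:
  assumes "parse_starts w c S" "\<And>b. b \<in> {u..<v} \<Longrightarrow> v \<le> next_start w b"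
  shows "card (S \<inter> {u..<v}) \<le> 1"
proof -
  have "a = b" if "a \<in> S \<inter> {u..<v}" "b \<in> S \<inter> {u..<v}" for a b
    using that assms unfolding parse_starts_def
    by (metis IntE atLeastLessThan_iff leD linorder_neqE_nat order_trans)
  then show ?thesis
    using parse_starts_finite[OF assms(1)] by (auto simp: card_le_Suc0_iff_eq)
qed

lemma card_starts_split:
  assumes "parse_starts w c S"
  shows "card (S \<inter> {u..<v}) \<le> card (S \<inter> {u..<m}) + card (S \<inter> {m..<v})"
proof -
  have "card (S \<inter> {u..<v}) \<le> card ((S \<inter> {u..<m}) \<union> (S \<inter> {m..<v}))"
    using parse_starts_finite[OF assms] by (intro card_mono) auto
  also have "\<dots> \<le> card (S \<inter> {u..<m}) + card (S \<inter> {m..<v})"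
    by (rule card_Un_le)
  finally show ?thesis .
qed

text \<open>Blocks are disjoint intervals of positions. This supplies the length budget for the
  counting of pairs.\<close>

lemma sum_block_lengths_le:
  assumes "parse_starts w 0 S" "T \<subseteq> S"
  shows "(\<Sum>a\<in>T. next_start w a - a) \<le> length w"
proof -
  have S: "S \<subseteq> {..<length w}" "\<And>a b. a \<in> S \<Longrightarrow> b \<in> S \<Longrightarrow> a < b \<Longrightarrow> next_start w a \<le> b"
    using assms(1) by (auto simp: parse_starts_def)
  have "finite T"
    using parse_starts_finite[OF assms(1)] assms(2) finite_subset by blast
  then have "(\<Sum>a\<in>T. next_start w a - a) = card (\<Union>a\<in>T. {a..<next_start w a})"
  proof (subst card_UN_disjoint)
    show "\<forall>a\<in>T. \<forall>b\<in>T. a \<noteq> b \<longrightarrow> {a..<next_start w a} \<inter> {b..<next_start w b} = {}"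
    proof (intro ballI impI)
      fix a b assume "a \<in> T" "b \<in> T" "a \<noteq> b"
      then have "next_start w a \<le> b \<or> next_start w b \<le> a"
        using S(2) assms(2) by (meson linorder_neqE_nat subsetD)
      then show "{a..<next_start w a} \<inter> {b..<next_start w b} = {}"
        by auto
    qed
  qed auto
  also have "\<dots> \<le> card {..<length w}"
  proof (rule card_mono)
    show "(\<Union>a\<in>T. {a..<next_start w a}) \<subseteq> {..<length w}"
      using S(1) assms(2) next_start_le[of _ w] by fastforce
  qed simp
  finally show ?thesis by simp
qed

section \<open>Block starts of \<open>w'\<close> inside one block of \<open>w\<close>\<close>

text \<open>Cutting the block after \<open>p\<close> and after \<open>p + d\<close> leaves at most
  three pieces on which the copy survives in \<open>w'\<close>. If \<open>p\<close> is outside the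
  block, only the cut after \<open>p + d\<close> can occur. The third claim records what such a cut
  forces: \<open>p\<close> precedes the block, and its offset \<open>p - (a - d)\<close> in the
  source is smaller than the copy length.\<close>

lemma card_starts_in_block:
  assumes S': "parse_starts w' 0 S'" and len: "length w' = length w" and a: "a < length w"
    and diff: "\<forall>i<length w. i \<noteq> p \<longrightarrow> w' ! i = w ! i"
  shows "card (S' \<inter> {a..<next_start w a}) \<le> 3"
    and "p \<notin> {a..<next_start w a} \<Longrightarrow> card (S' \<inter> {a..<next_start w a}) \<le> 2"
    and "p \<notin> {a..<next_start w a} \<Longrightarrow> 2 \<le> card (S' \<inter> {a..<next_start w a}) \<Longrightarrow>
      \<exists>d. 1 \<le> d \<and> d \<le> a \<and> p < a \<and> a \<le> p + d \<and> p + d + 1 < next_start w a \<and>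
        (\<forall>i. a \<le> i \<and> i + 1 < next_start w a \<longrightarrow> w ! i = w ! (i - d))"
proof -
  let ?e = "next_start w a" and ?N = "\<lambda>u v. card (S' \<inter> {u..<v})"
  have "?N a ?e \<le> 3 \<and> (p \<notin> {a..<?e} \<longrightarrow> ?N a ?e \<le> 2) \<and>
     (p \<notin> {a..<?e} \<longrightarrow> 2 \<le> ?N a ?e \<longrightarrow>
      (\<exists>d. 1 \<le> d \<and> d \<le> a \<and> p < a \<and> a \<le> p + d \<and> p + d + 1 < ?e \<and>
        (\<forall>i. a \<le> i \<and> i + 1 < ?e \<longrightarrow> w ! i = w ! (i - d))))"
    using a
  proof (cases rule: next_start_copy)
    case 1
    have "?N a ?e \<le> 1"
      by (rule card_starts_le_1[OF S']) (use 1 next_start_gt[of a w'] in auto)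
    then show ?thesis by auto
  next
    case (2 d)
    \<comment> \<open>A broken position may still be the last one of a piece, where it serves as
      explicit character; hence the cuts at \<open>p + 1\<close> and
      \<open>p + d + 1\<close>.\<close>
    have copy: "?N u v \<le> 1"
      if "a \<le> u" "v \<le> ?e" "\<And>i. u \<le> i \<Longrightarrow> i + 1 < v \<Longrightarrow> i \<noteq> p \<and> i \<noteq> p + d" for u v
    proof (rule card_starts_le_1[OF S'])
      fix b assume b: "b \<in> {u..<v}"
      show "v \<le> next_start w' b"
      proof (rule le_next_start[of d u v])
        fix i assume i: "u \<le> i" "i + 1 < v"
        then have "i \<noteq> p" "i - d \<noteq> p"
          using that(3)[OF i] 2 \<open>a \<le> u\<close> by auto
        then have "w' ! i = w ! i" "w' ! (i - d) = w ! (i - d)"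
          using diff i that 2 by auto
        then show "w' ! i = w' ! (i - d)"
          using 2(4) i that by auto
      qed (use 2 b that len in auto)
    qed
    have split: "?N a ?e \<le> ?N a m + ?N m ?e" "?N m ?e \<le> ?N m m' + ?N m' ?e" for m m'
      using card_starts_split[OF S'] by blast+
    \<comment> \<open>The tests are strict at the right end: a change at the explicit character,
      where \<open>p + 1 = ?e\<close>, breaks nothing.\<close>
    consider (none) "\<not> (a \<le> p \<and> p + 1 < ?e)" "\<not> (a \<le> p + d \<and> p + d + 1 < ?e)"
      | (source) "\<not> (a \<le> p \<and> p + 1 < ?e)" "a \<le> p + d" "p + d + 1 < ?e"
      | (target) "a \<le> p" "p + 1 < ?e" "\<not> (p + d + 1 < ?e)"
      | (both) "a \<le> p" "p + 1 < ?e" "p + d + 1 < ?e"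
      by linarith
    then show ?thesis
    proof cases
      case none
      then have "?N a ?e \<le> 1" by (intro copy) auto
      then show ?thesis by auto
    next
      case source
      then have "p < a" by linarith
      have "?N a (p + d + 1) \<le> 1" "?N (p + d + 1) ?e \<le> 1"
        by (rule copy; use source \<open>p < a\<close> in auto)+
      with split(1)[of "p + d + 1"] have "?N a ?e \<le> 2" by linarith
      with source 2 \<open>p < a\<close> show ?thesis
        by (intro conjI impI exI[of _ d]) auto
    next
      case target
      have "?N a (p + 1) \<le> 1" "?N (p + 1) ?e \<le> 1"
        by (rule copy; use target 2 in auto)+
      with split(1)[of "p + 1"] have "?N a ?e \<le> 2" by linarith
      with target show ?thesis by auto
    next
      case both
      have "?N a (p + 1) \<le> 1" "?N (p + 1) (p + d + 1) \<le> 1" "?N (p + d + 1) ?e \<le> 1"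
        by (rule copy; use both 2 in auto)+
      with split(1)[of "p + 1"] split(2)[of "p + 1" "p + d + 1"] have "?N a ?e \<le> 3" by linarith
      with both show ?thesis by auto
    qed
  qed
  then show "?N a ?e \<le> 3" "p \<notin> {a..<?e} \<Longrightarrow> ?N a ?e \<le> 2"
    "p \<notin> {a..<?e} \<Longrightarrow> 2 \<le> ?N a ?e \<Longrightarrow>
      \<exists>d. 1 \<le> d \<and> d \<le> a \<and> p < a \<and> a \<le> p + d \<and> p + d + 1 < ?e \<and>
        (\<forall>i. a \<le> i \<and> i + 1 < ?e \<longrightarrow> w ! i = w ! (i - d))"
    by blast+
qed

section \<open>Counting pairs of copy length and offset\<close>

text \<open>The factor \<open>real l\<close> counts the offsets \<open>j < l\<close>, so this is the
  total of the weights 1 - l/m over all pairs with j < l < m.\<close>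

lemma sum_dual_weights: "real m > 0 \<Longrightarrow> (\<Sum>l<m. real l * (1 - real l / real m)) = ((real m)\<^sup>2 - 1) / 6"
proof -
  assume m: "real m > 0"
  have 1: "(\<Sum>l<k. real l) = real k * (real k - 1) / 2" for k
    by (induction k) (auto simp: field_simps)
  have 2: "(\<Sum>l<k. (real l)\<^sup>2) = real k * (real k - 1) * (2 * real k - 1) / 6" for k
    by (induction k) (auto simp: field_simps power2_eq_square)
  have "(\<Sum>l<m. real l * (1 - real l / real m)) = (\<Sum>l<m. real l) - (\<Sum>l<m. (real l)\<^sup>2) / real m"
    by (simp add: sum_subtractf sum_divide_distrib right_diff_distrib power2_eq_square)
  also have "\<dots> = ((real m)\<^sup>2 - 1) / 6"
    using m unfolding 1 2 by (simp add: field_simps power2_eq_square)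
  finally show ?thesis .
qed

text \<open>Linear programming duality: the weight \<open>max 0 (1 - l / m) + l / m\<close> is at least 1.\<close>

lemma card_pairs_le_weighted:
  fixes P :: "(nat \<times> nat) set"
  assumes P: "finite P" "\<And>l j. (l, j) \<in> P \<Longrightarrow> j < l" and sum: "(\<Sum>z\<in>P. fst z) \<le> n"
    and m: "real m > 0"
  shows "real (card P) \<le> ((real m)\<^sup>2 - 1) / 6 + real n / real m"
proof -
  let ?f = "\<lambda>l. 1 - real l / real m"
  let ?Q = "Sigma {..<m} (\<lambda>l. {..<l})"
  have "real (card P) - (\<Sum>z\<in>P. real (fst z)) / real m = (\<Sum>z\<in>P. ?f (fst z))"
    by (simp add: sum_subtractf sum_divide_distrib)
  also have "\<dots> \<le> (\<Sum>z\<in>P. if fst z < m then ?f (fst z) else 0)"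
    using m by (intro sum_mono) (auto simp: field_simps)
  also have "\<dots> = (\<Sum>z\<in>P \<inter> {z. fst z < m}. ?f (fst z))"
    using P(1) by (simp add: sum.inter_restrict)
  also have "\<dots> \<le> (\<Sum>z\<in>?Q. ?f (fst z))"
    using m P(2) by (intro sum_mono2) (auto simp: field_simps)
  also have "\<dots> = (\<Sum>l<m. \<Sum>j<l. ?f l)"
    by (subst sum.Sigma) (auto simp: case_prod_beta)
  also have "\<dots> = ((real m)\<^sup>2 - 1) / 6"
    using sum_dual_weights[OF m] by simp
  finally have "real (card P) \<le> ((real m)\<^sup>2 - 1) / 6 + (\<Sum>z\<in>P. real (fst z)) / real m"
    by linarith
  moreover have "(\<Sum>z\<in>P. real (fst z)) \<le> real n"
    using sum by (metis of_nat_mono of_nat_sum)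
  then have "(\<Sum>z\<in>P. real (fst z)) / real m \<le> real n / real m"
    using m by (simp add: divide_right_mono)
  ultimately show ?thesis by linarith
qed

lemma card_pairs_le:
  fixes P :: "(nat \<times> nat) set"
  assumes P: "finite P" "\<And>l j. (l, j) \<in> P \<Longrightarrow> j < l" and sum: "(\<Sum>z\<in>P. fst z) \<le> n"
    and n: "n \<ge> 1"
  shows "real (card P) \<le> root 3 9 / 2 * real n powr (2/3) + root 3 3 / 2 * real n powr (1/3)"
proof -
  \<comment> \<open>The real minimizer of m^2/6 + n/m satisfies m^3 = 3n. Rounding it up to an
    integer costs only a term linear in \<open>x\<close>.\<close>
  define x where "x = root 3 (3 * real n)"
  have x3: "x ^ 3 = 3 * real n" and x0: "x > 0"
    using n by (simp_all add: x_def)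
  define m where "m = nat \<lceil>x\<rceil>"
  have m: "x \<le> real m" "real m < x + 1"
    using x0 unfolding m_def by linarith+
  have "real n / real m \<le> x\<^sup>2 / 3"
  proof -
    have "real n = x\<^sup>2 / 3 * x"
      using x3 by (simp add: power2_eq_square power3_eq_cube)
    also have "\<dots> \<le> x\<^sup>2 / 3 * real m"
      using m by (intro mult_left_mono) auto
    finally show ?thesis
      using m x0 by (simp add: divide_le_eq)
  qed
  moreover have "(real m)\<^sup>2 \<le> (x + 1)\<^sup>2"
    using m by (intro power_mono) auto
  moreover have "(x + 1)\<^sup>2 = x\<^sup>2 + 2 * x + 1"
    by (simp add: power2_eq_square algebra_simps)
  ultimately have "((real m)\<^sup>2 - 1) / 6 + real n / real m \<le> x\<^sup>2 / 2 + x / 2"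
    using x0 by argo
  moreover have "real (card P) \<le> ((real m)\<^sup>2 - 1) / 6 + real n / real m"
    using m x0 by (intro card_pairs_le_weighted[OF P sum]) auto
  moreover have r: "root 3 (real n) = real n powr (1/3)"
    using n by (simp add: root_powr_inverse)
  then have x: "x = root 3 3 * real n powr (1/3)"
    by (simp add: x_def real_root_mult)
  moreover have "x\<^sup>2 = root 3 9 * real n powr (2/3)"
  proof -
    have "(root 3 3)\<^sup>2 = root 3 9"
      by (simp flip: real_root_power)
    moreover have "(real n powr (1/3))\<^sup>2 = real n powr (2/3)"
      using n by (simp add: powr_powr flip: powr_realpow)
    ultimately show ?thesis
      by (simp add: x power_mult_distrib)
  qed
  ultimately show ?thesis by simp
qed

section \<open>Comparing the two block counts\<close>

text \<open>One direction suffices, since neighbors can be exchanged. The constant 2 pays for the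
  block of \<open>w\<close> that contains \<open>p\<close>.\<close>

lemma blocks_diff_le:
  assumes nb: "neighbors w w'" and n: "length w \<ge> 1"
  shows "real (length (lz77_blocks (length w') w')) \<le> real (length (lz77_blocks (length w) w))
    + (root 3 9 / 2 * real (length w) powr (2/3) + root 3 3 / 2 * real (length w) powr (1/3) + 2)"
proof -
  define e where "e = next_start w"
  have len: "length w' = length w"
    using nb by (simp add: neighbors_def)
  obtain p where diff: "\<forall>i<length w. i \<noteq> p \<longrightarrow> w' ! i = w ! i"
    using nb unfolding neighbors_def by metis
  obtain S where S: "parse_starts w 0 S" "card S = length (lz77_blocks (length w) w)"
    using parse_starts_exists[of w 0] by (auto simp: lz77_blocks_def)
  obtain S' where S': "parse_starts w' 0 S'" "card S' = length (lz77_blocks (length w') w')"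
    using parse_starts_exists[of w' 0] by (auto simp: lz77_blocks_def)
  note fin = parse_starts_finite[OF S(1)] parse_starts_finite[OF S'(1)]
  have sub: "S \<subseteq> {..<length w}" "S' \<subseteq> {..<length w}"
    and cover: "{..<length w} \<subseteq> (\<Union>a\<in>S. {a..<e a})"
    and sep: "\<And>a b. a \<in> S \<Longrightarrow> b \<in> S \<Longrightarrow> a < b \<Longrightarrow> e a \<le> b"
    using S(1) S'(1) len unfolding parse_starts_def e_def by (auto simp: atLeast0LessThan)
  note in_block = card_starts_in_block[OF S'(1) len _ diff, folded e_def]
  \<comment> \<open>Each block of \<open>w\<close> is charged 1, those in \<open>T\<close> one more,
    and those in \<open>R\<close> two more; this matches the bounds 1, 2 and 3 on the starts of
    \<open>w'\<close> inside it.\<close>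
  define T where "T = {a \<in> S. p \<notin> {a..<e a} \<and> 2 \<le> card (S' \<inter> {a..<e a})}"
  define R where "R = {a \<in> S. p \<in> {a..<e a}}"
  have "T \<subseteq> S" "R \<subseteq> S" by (auto simp: T_def R_def)
  then have fin_T: "finite T" and fin_R: "finite R"
    using fin finite_subset by blast+
  have "card R \<le> 1"
  proof -
    have "a = b" if "a \<in> R" "b \<in> R" for a b
      using that sep[of a b] sep[of b a] unfolding R_def by (cases a b rule: linorder_cases) auto
    then show ?thesis
      using fin_R by (auto simp: card_le_Suc0_iff_eq)
  qed
  have "card S' \<le> card (\<Union>a\<in>S. S' \<inter> {a..<e a})"
    using fin sub(2) cover by (intro card_mono) auto
  also have "\<dots> \<le> (\<Sum>a\<in>S. card (S' \<inter> {a..<e a}))"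
    by (rule card_UN_le[OF fin(1)])
  also have "\<dots> \<le> (\<Sum>a\<in>S. 1 + ((if a \<in> T then 1 else 0) + (if a \<in> R then 2 else 0)))"
  proof (rule sum_mono)
    fix a assume a: "a \<in> S"
    then have "a < length w" using sub by auto
    from in_block(1,2)[OF this] a
    show "card (S' \<inter> {a..<e a}) \<le> 1 + ((if a \<in> T then 1 else 0) + (if a \<in> R then 2 else 0))"
      by (auto simp: T_def R_def)
  qed
  also have "\<dots> = card S + (card T + 2 * card R)"
    using fin(1) \<open>T \<subseteq> S\<close> \<open>R \<subseteq> S\<close>
    unfolding sum.distrib by (simp add: sum.If_cases Int_absorb1)
  finally have count: "card S' \<le> card S + (card T + 2)"
    using \<open>card R \<le> 1\<close> by linarith

  have "\<exists>d. 1 \<le> d \<and> d \<le> a \<and> p < a \<and> a \<le> p + d \<and> p + d + 1 < e a \<and>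
      (\<forall>i. a \<le> i \<and> i + 1 < e a \<longrightarrow> w ! i = w ! (i - d))" if "a \<in> T" for a
    using that sub(1) in_block(3)[of a] by (auto simp: T_def)
  then obtain d where d: "\<And>a. a \<in> T \<Longrightarrow> 1 \<le> d a \<and> d a \<le> a \<and> p < a \<and> a \<le> p + d a \<and>
      p + d a + 1 < e a \<and> (\<forall>i. a \<le> i \<and> i + 1 < e a \<longrightarrow> w ! i = w ! (i - d a))"
    by metis
  \<comment> \<open>The copy length without the explicit character, and the offset of
    \<open>p\<close> in the source, which starts at \<open>a - d a\<close>. The subtraction in the
    offset is exact because \<open>a \<le> p + d a\<close>.\<close>
  define f where "f a = (e a - 1 - a, p + d a - a)" for a
  \<comment> \<open>Equal pairs mean the same source start and the same length, so in
    \<open>w\<close> both blocks copy the same text. Both lie after \<open>p\<close> and are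
    unchanged in \<open>w'\<close>, so there the later one can be copied from distance
    \<open>b - a\<close>, avoiding the damaged source. It then holds at most one start, against
    \<open>b \<in> T\<close>.\<close>
  have f_neq: False if "a \<in> T" "b \<in> T" "a < b" "f a = f b" for a b
  proof -
    note da = d[OF that(1)] and db = d[OF that(2)]
    have b: "b \<in> S" "2 \<le> card (S' \<inter> {b..<e b})"
      using that by (auto simp: T_def)
    have eqs: "e b - b = e a - a" "b - d b = a - d a"
      using that(4) da db by (auto simp: f_def)
    have "card (S' \<inter> {b..<e b}) \<le> 1"
    proof (rule card_starts_le_1[OF S'(1)])
      fix c assume c: "c \<in> {b..<e b}"
      show "e b \<le> next_start w' c"
      proof (rule le_next_start[of "b - a" b])
        show "e b \<le> length w'"
          using sub(1) b(1) len next_start_le[of b w] by (auto simp: e_def)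
        fix i assume i: "b \<le> i" "i + 1 < e b"
        define k where "k = i - b"
        have k: "i = b + k" "i - (b - a) = a + k" "a + k + 1 < e a"
          using i that eqs da db by (auto simp: k_def)
        have "w ! (b + k) = w ! (b + k - d b)" "w ! (a + k) = w ! (a + k - d a)"
          using i k da db by auto
        moreover have "b + k - d b = a + k - d a"
          using eqs da db by linarith
        moreover have "i < length w"
          using i \<open>e b \<le> length w'\<close> len by simp
        ultimately show "w' ! i = w' ! (i - (b - a))"
          unfolding k(2) using diff[rule_format, of "b + k"] diff[rule_format, of "a + k"] k(1) da db that by auto
      qed (use that c in auto)
    qed
    with b show False by simp
  qed
  then have inj: "inj_on f T"
    by (metis inj_onI linorder_neqE_nat)
  have "(\<Sum>z\<in>f ` T. fst z) = (\<Sum>a\<in>T. e a - 1 - a)"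
    by (simp add: sum.reindex[OF inj]) (simp add: f_def)
  also have "\<dots> \<le> (\<Sum>a\<in>T. e a - a)"
    by (rule sum_mono) simp
  also have "\<dots> \<le> length w"
    unfolding e_def by (rule sum_block_lengths_le[OF S(1) \<open>T \<subseteq> S\<close>])
  finally have "real (card (f ` T)) \<le>
      root 3 9 / 2 * real (length w) powr (2/3) + root 3 3 / 2 * real (length w) powr (1/3)"
    using n fin_T d by (intro card_pairs_le) (fastforce simp: f_def)+
  then have "real (card T) \<le>
      root 3 9 / 2 * real (length w) powr (2/3) + root 3 3 / 2 * real (length w) powr (1/3)"
    using inj by (simp add: card_image)
  with count show ?thesis
    unfolding S'(2) S(2) by simp
qed

section \<open>From block counts to global sensitivity\<close>

lemma neighbors_sym: "neighbors w w' \<Longrightarrow> neighbors w' w"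
  by (auto simp: neighbors_def eq_commute)

text \<open>\<open>0 \<le> B\<close> serves the empty index set, whose supremum on
  \<open>nat\<close> is 0; this happens for strings without neighbors.\<close>

lemma SUP_nat_le:
  fixes f :: "'b \<Rightarrow> nat" and B :: real
  assumes "\<And>x. x \<in> A \<Longrightarrow> real (f x) \<le> B" "0 \<le> B"
  shows "real (SUP x\<in>A. f x) \<le> B"
proof (cases "A = {}")
  case True
  then show ?thesis using assms(2) by (simp add: Sup_nat_empty)
next
  case False
  then have "(SUP x\<in>A. f x) \<le> nat \<lfloor>B\<rfloor>"
    using assms by (intro cSUP_least) (auto simp: le_nat_floor)
  then show ?thesis using assms(2) by linarith
qed

lemma of_nat_bits_for: "n \<ge> 1 \<Longrightarrow> real (bits_for n) = of_int \<lceil>log 2 (real n)\<rceil>"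
  by (simp add: bits_for_def zero_le_log_cancel_iff order.trans[of _ 0])

theorem theorem6:
  fixes \<Sigma> :: "'a set" and bound :: "nat \<Rightarrow> real"
  assumes "finite \<Sigma>" and "\<Sigma> \<noteq> {}"
  defines "bound \<equiv> \<lambda>n. (root 3 9 / 2 * real n powr (2/3) + root 3 3 / 2 * real n powr (1/3) + 3)
      * (2 * of_int \<lceil>log 2 (real n)\<rceil> + of_int \<lceil>log 2 (real (card \<Sigma>))\<rceil>)"
  shows "(\<forall>n\<ge>1. real (global_sensitivity (compress_SR \<Sigma>) \<Sigma> n) \<le> bound n)
    \<and> bound \<in> O(\<lambda>n. real n powr (2/3) * log 2 (real n))
    \<and> (\<lambda>n. real (global_sensitivity (compress_SR \<Sigma>) \<Sigma> n))
         \<in> O(\<lambda>n. real n powr (2/3) * log 2 (real n))"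
proof -
  have card: "card \<Sigma> \<ge> 1"
    using assms(1,2) by (simp add: Suc_le_eq card_gt_0_iff)
  define g where "g n = root 3 9 / 2 * real n powr (2/3) + root 3 3 / 2 * real n powr (1/3) + 3"
    for n
  define k where "k n = 2 * bits_for n + bits_for (card \<Sigma>)" for n
  have bound_eq: "bound n = g n * real (k n)" if "n \<ge> 1" for n
    using that card by (simp add: bound_def g_def k_def of_nat_bits_for)
  have g0: "g n \<ge> 0" for n
    by (simp add: g_def)
  have GS: "real (global_sensitivity (compress_SR \<Sigma>) \<Sigma> n) \<le> bound n" if n: "n \<ge> 1" for n
  proof -
    have "real (nat \<bar>int (length (compress_SR \<Sigma> w)) - int (length (compress_SR \<Sigma> w'))\<bar>) \<le> bound n"
      if "length w = n" "length w' = n" "neighbors w w'" for w w'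
    proof -
      let ?t = "length (lz77_blocks (length w) w)" and ?t' = "length (lz77_blocks (length w') w')"
      \<comment> \<open>Both orders of the two strings give the absolute value; the additive 2 of
        \<open>blocks_diff_le\<close> stays below the 3 in \<open>g\<close>.\<close>
      have "\<bar>real ?t - real ?t'\<bar> \<le> g n"
        using blocks_diff_le[of w w'] blocks_diff_le[of w' w] neighbors_sym[of w w'] that n
        by (auto simp: g_def)
      then have "\<bar>real ?t - real ?t'\<bar> * real (k n) \<le> bound n"
        unfolding bound_eq[OF n] by (intro mult_right_mono) auto
      moreover have "real (nat \<bar>int (length (compress_SR \<Sigma> w)) - int (length (compress_SR \<Sigma> w'))\<bar>)
          = \<bar>real ?t * real (k n) - real ?t' * real (k n)\<bar>"
        using that by (simp add: compress_SR_def length_lz77_compress k_def)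
      ultimately show ?thesis
        by (simp add: abs_mult flip: left_diff_distrib)
    qed
    then show ?thesis
      unfolding global_sensitivity_def using g0 bound_eq[OF n]
      by (intro SUP_nat_le) (auto simp: strings_def)
  qed
  moreover have bigo: "bound \<in> O(\<lambda>n. real n powr (2/3) * log 2 (real n))"
    unfolding bound_def
  proof (rule landau_o.big.mult)
    show "(\<lambda>n. root 3 9 / 2 * real n powr (2/3) + root 3 3 / 2 * real n powr (1/3) + 3)
        \<in> O(\<lambda>n. real n powr (2/3))"
      by real_asymp
    show "(\<lambda>n. 2 * of_int \<lceil>log 2 (real n)\<rceil> + of_int \<lceil>log 2 (real (card \<Sigma>))\<rceil>)
        \<in> O(\<lambda>n. log 2 (real n))"
      by real_asymp
  qed
  moreover have "(\<lambda>n. real (global_sensitivity (compress_SR \<Sigma>) \<Sigma> n))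
      \<in> O(\<lambda>n. real n powr (2/3) * log 2 (real n))"
  proof (rule landau_o.big_trans[OF _ bigo])
    show "(\<lambda>n. real (global_sensitivity (compress_SR \<Sigma>) \<Sigma> n)) \<in> O(bound)"
      using GS by (intro landau_o.big_mono eventually_sequentiallyI[of 1]) fastforce
  qed
  ultimately show ?thesis by blast
qed

end
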